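(* The states in $\mathbb{C}^2\otimes\mathbb{C}^2$ that are entangled, diagonal, and orthogonal to $|00\rangle_{AB}$ are exactly the states characterized by two non-zero complex numbers $a,b$ with $|a|^2+|b|^2=1$ through the Schmidt decomposition $$|\psi\rangle_{AB}=|a|\left(\frac{a}{|a|}|01\rangle_{AB}\right)+|b|\left(\frac{b}{|b|}|10\rangle_{AB}\right).$$
   Context: $|0\rangle,|1\rangle$ is the standard basis of $\mathbb{C}^2$ and $|jk\rangle_{AB}=|j\rangle_A\otimes|k\rangle_B$. A state is a unit vector; a state in $\mathbb{C}^2\otimes\mathbb{C}^2$ is a product state if it equals $|u\rangle\otimes|v\rangle$, and entangled otherwise. A state $\sum_{j,k}c_{jk}|jk\rangle_{AB}$ is called diagonal if $c_{00}^*c_{01}+c_{10}^*c_{11}=0$. A Schmidt decomposition of a state is an expression $\sum_j\lambda_j|u_j\rangle\otimes|v_j\rangle$ with $\lambda_j\ge 0$ and $\{|u_j\rangle\}$, $\{|v_j\rangle\}$ orthonormal families in $\mathbb{C}^2$ (phases such as $a/|a|$ may be absorbed into either tensor factor). *)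

theory Defs
  imports "HOL-Analysis.Analysis"
begin

text \<open>
  Both factors have index type \<^typ>\<open>2\<close>, whose two elements are 0 and 1, so that a vector of
  the tensor product is its family of coefficients with respect to the product basis. The norm
  is the library's Euclidean norm; the library's inner product on these types is only real
  bilinear, hence the complex one below.
\<close>

type_synonym qubit = "complex ^ 2"
type_synonym two_qubit = "complex ^ (2 \<times> 2)"

definition cinner :: "complex ^ 'n \<Rightarrow> complex ^ 'n \<Rightarrow> complex" where
  "cinner x y = (\<Sum>i\<in>UNIV. cnj (x $ i) * y $ i)"

definition tensor :: "qubit \<Rightarrow> qubit \<Rightarrow> two_qubit"  (infixr \<open>\<otimes>\<close> 75) where
  "u \<otimes> v = (\<chi> p. u $ fst p * v $ snd p)"

definition ket :: "2 \<Rightarrow> qubit" where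
  "ket j = axis j 1"

definition ket2 :: "2 \<Rightarrow> 2 \<Rightarrow> two_qubit" where
  "ket2 j k = ket j \<otimes> ket k"

lemma two_qubit_expansion:
  fixes \<psi> :: two_qubit
  shows "\<psi> = (\<Sum>j\<in>UNIV. \<Sum>k\<in>UNIV. \<psi> $ (j, k) *s ket2 j k)"
  by (simp add: vec_eq_iff split_paired_All forall_2 ket2_def ket_def tensor_def axis_def UNIV_2)

definition is_state :: "complex ^ 'n \<Rightarrow> bool" where
  "is_state \<psi> \<longleftrightarrow> norm \<psi> = 1"

lemma is_state_iff_cinner: "is_state \<psi> \<longleftrightarrow> cinner \<psi> \<psi> = 1"
proof -
  have "cinner \<psi> \<psi> = complex_of_real ((norm \<psi>)\<^sup>2)"
    by (simp add: cinner_def norm_vec_def L2_set_def sum_nonneg complex_norm_square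
        mult.commute del: of_real_power)
  then have "cinner \<psi> \<psi> = 1 \<longleftrightarrow> (norm \<psi>)\<^sup>2 = 1"
    by (simp only: of_real_eq_1_iff)
  then show ?thesis
    using norm_ge_zero[of \<psi>] by (auto simp: is_state_def power2_eq_1_iff)
qed

definition product_state :: "two_qubit \<Rightarrow> bool" where
  "product_state \<psi> \<longleftrightarrow> is_state \<psi> \<and> (\<exists>u v. \<psi> = u \<otimes> v)"

definition entangled :: "two_qubit \<Rightarrow> bool" where
  "entangled \<psi> \<longleftrightarrow> is_state \<psi> \<and> \<not> product_state \<psi>"

definition diagonal :: "two_qubit \<Rightarrow> bool" where
  "diagonal \<psi> \<longleftrightarrow> is_state \<psi> \<and>
     cnj (\<psi> $ (0, 0)) * \<psi> $ (0, 1) + cnj (\<psi> $ (1, 0)) * \<psi> $ (1, 1) = 0"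

definition orthonormal_family :: "(complex ^ 'n) list \<Rightarrow> bool" where
  "orthonormal_family us \<longleftrightarrow>
     (\<forall>i<length us. \<forall>j<length us. cinner (us ! i) (us ! j) = (if i = j then 1 else 0))"

text \<open>
  An expression is the list of its coefficients together with its product vectors.
  Quantifying over the factors of each product vector leaves open into
  which of the two factors a phase is absorbed.
\<close>

definition schmidt_decomposition :: "two_qubit \<Rightarrow> (real \<times> two_qubit) list \<Rightarrow> bool" where
  "schmidt_decomposition \<psi> ts \<longleftrightarrow>
     \<psi> = (\<Sum>(l, t)\<leftarrow>ts. complex_of_real l *s t) \<and>
     (\<forall>(l, t)\<in>set ts. 0 \<le> l) \<and>
     (\<exists>us vs. length us = length ts \<and> length vs = length ts \<and>
        orthonormal_family us \<and> orthonormal_family vs \<and>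
        map snd ts = map2 (\<otimes>) us vs)"

end

theory Submission
  imports Defs
begin

text \<open>
  Being a product state is the vanishing of the coefficient determinant. Orthogonality to the
  first basis vector reduces this determinant to the product of the two mixed coefficients, so
  for entangled states both of them are nonzero, and diagonality then forces the last coefficient
  to vanish.
\<close>

text \<open>\<open>exhaust_2\<close> lists the elements as 1 and 2; numerals of this type are read
  modulo 2, so 2 is the index 0 of the first basis vector.\<close>

lemma type_2_cases: "x = 0 \<or> x = 1" for x :: 2
proof -
  have "(2 :: 2) = 0"
    by simp
  then show ?thesis
    using exhaust_2[of x] by metis
qed

lemma all_type_2: "(\<forall>x :: 2. P x) \<longleftrightarrow> P 0 \<and> P 1"
  using type_2_cases by metis

lemma two_qubit_eq_iff:
  fixes \<psi> \<phi> :: two_qubit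
  shows "\<psi> = \<phi> \<longleftrightarrow> \<psi> $ (0, 0) = \<phi> $ (0, 0) \<and> \<psi> $ (0, 1) = \<phi> $ (0, 1) \<and>
    \<psi> $ (1, 0) = \<phi> $ (1, 0) \<and> \<psi> $ (1, 1) = \<phi> $ (1, 1)"
  by (auto simp: vec_eq_iff split_paired_All all_type_2)

lemma sum_UNIV_2_times_2:
  fixes f :: "2 \<times> 2 \<Rightarrow> 'a :: comm_monoid_add"
  shows "(\<Sum>p\<in>UNIV. f p) = f (0, 0) + f (0, 1) + (f (1, 0) + f (1, 1))"
proof -
  have "(\<Sum>p\<in>UNIV. f p) = (\<Sum>j\<in>UNIV. \<Sum>k\<in>UNIV. f (j, k))"
    by (simp add: sum.cartesian_product flip: UNIV_Times_UNIV)
  also have "(UNIV :: 2 set) = {0, 1}"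
    using type_2_cases by auto
  finally show ?thesis
    by simp
qed

lemma ket2_nth [simp]: "ket2 j k $ (l, m) = (if l = j \<and> m = k then 1 else 0)"
  by (simp add: ket2_def ket_def tensor_def axis_def)

lemma cinner_ket2 [simp]: "cinner (ket2 j k) \<psi> = \<psi> $ (j, k)"
proof -
  have "cinner (ket2 j k) \<psi> = (\<Sum>p\<in>UNIV. if p = (j, k) then \<psi> $ p else 0)"
    unfolding cinner_def by (intro sum.cong) (auto simp: split_paired_all)
  then show ?thesis
    by simp
qed

lemma cinner_ket: "cinner (ket j) (ket k) = (if j = k then 1 else 0)"
proof -
  have "cinner (ket j) (ket k) = (\<Sum>i\<in>UNIV. if i = j then if j = k then 1 else 0 else 0)"
    unfolding cinner_def by (intro sum.cong) (auto simp: ket_def axis_def)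
  then show ?thesis
    by simp
qed

lemma cinner_scale: "cinner (c *s x) (d *s y) = cnj c * d * cinner x y"
  by (simp add: cinner_def sum_distrib_left ac_simps)

lemma tensor_scale_left: "(c *s u) \<otimes> v = c *s (u \<otimes> v)"
  by (simp add: tensor_def vec_eq_iff)

lemma is_state_two_qubit_iff:
  fixes \<psi> :: two_qubit
  shows "is_state \<psi> \<longleftrightarrow> (cmod (\<psi> $ (0, 0)))\<^sup>2 + (cmod (\<psi> $ (0, 1)))\<^sup>2 +
    ((cmod (\<psi> $ (1, 0)))\<^sup>2 + (cmod (\<psi> $ (1, 1)))\<^sup>2) = 1"
  by (simp only: is_state_def norm_vec_def L2_set_def sum_UNIV_2_times_2 real_sqrt_eq_1_iff)

text \<open>The coefficients of \<open>u \<otimes> v\<close> form an outer product, so both sides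
  say that the 2 by 2 coefficient matrix has rank at most one.\<close>

lemma tensor_iff_det_eq_0:
  fixes \<psi> :: two_qubit
  shows "(\<exists>u v. \<psi> = u \<otimes> v) \<longleftrightarrow> \<psi> $ (0, 0) * \<psi> $ (1, 1) = \<psi> $ (0, 1) * \<psi> $ (1, 0)"
proof
  assume "\<exists>u v. \<psi> = u \<otimes> v"
  then show "\<psi> $ (0, 0) * \<psi> $ (1, 1) = \<psi> $ (0, 1) * \<psi> $ (1, 0)"
    by (auto simp: tensor_def)
next
  assume det: "\<psi> $ (0, 0) * \<psi> $ (1, 1) = \<psi> $ (0, 1) * \<psi> $ (1, 0)"
  show "\<exists>u v. \<psi> = u \<otimes> v"
  proof (cases "\<exists>j k. \<psi> $ (j, k) \<noteq> 0")
    case True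
    then obtain j k where jk: "\<psi> $ (j, k) \<noteq> 0"
      by blast
    \<comment> \<open>Trivial if l = j or m = k; otherwise the two entries on each side form a
      diagonal of the matrix, and this is \<open>det\<close> up to order.\<close>
    have minor: "\<psi> $ (l, m) * \<psi> $ (j, k) = \<psi> $ (l, k) * \<psi> $ (j, m)" for l m
      using type_2_cases[of j] type_2_cases[of k] type_2_cases[of l] type_2_cases[of m]
      by (elim disjE; hypsubst) (metis det mult.commute)+
    have "\<psi> $ (l, k) * \<psi> $ (j, m) / \<psi> $ (j, k) = \<psi> $ (l, m)" for l m
      unfolding minor[of l m, symmetric] using jk by simp
    \<comment> \<open>The factors are the column and the row through the pivot (j, k), the row
      divided by the pivot.\<close>
    then have "\<psi> = (\<chi> l. \<psi> $ (l, k)) \<otimes> (\<chi> m. \<psi> $ (j, m) / \<psi> $ (j, k))"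
      by (simp add: vec_eq_iff tensor_def)
    then show ?thesis
      by blast
  next
    case False
    then have "\<psi> = 0 \<otimes> 0"
      by (simp add: vec_eq_iff tensor_def)
    then show ?thesis
      by blast
  qed
qed

lemma entangled_iff:
  "entangled \<psi> \<longleftrightarrow> is_state \<psi> \<and> \<psi> $ (0, 0) * \<psi> $ (1, 1) \<noteq> \<psi> $ (0, 1) * \<psi> $ (1, 0)"
  by (auto simp: entangled_def product_state_def tensor_iff_det_eq_0)

lemma entangled_diagonal_orthogonal_iff:
  "is_state \<psi> \<and> entangled \<psi> \<and> diagonal \<psi> \<and> cinner (ket2 0 0) \<psi> = 0 \<longleftrightarrow>
    (\<exists>a b. \<psi> = a *s ket2 0 1 + b *s ket2 1 0 \<and> a \<noteq> 0 \<and> b \<noteq> 0 \<and> (cmod a)\<^sup>2 + (cmod b)\<^sup>2 = 1)"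
  (is "?L \<longleftrightarrow> ?R")
proof
  assume ?L
  then have "\<psi> $ (0, 0) = 0" "\<psi> $ (0, 1) \<noteq> 0" "\<psi> $ (1, 0) \<noteq> 0" "\<psi> $ (1, 1) = 0"
    "is_state \<psi>"
    by (auto simp: entangled_iff diagonal_def)
  then show ?R
    \<comment> \<open>The two surviving coefficients serve as a and b, and the unit norm becomes the
      condition on their moduli.\<close>
    by (intro exI[of _ "\<psi> $ (0, 1)"] exI[of _ "\<psi> $ (1, 0)"])
      (simp add: two_qubit_eq_iff is_state_two_qubit_iff)
next
  assume ?R
  then show ?L
    \<comment> \<open>The determinant is now -ab, and each term of the diagonality sum contains one
      of the vanishing coefficients.\<close>
    by (auto simp: entangled_iff diagonal_def is_state_two_qubit_iff)
qed

lemma schmidt_decomposition_01_10: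
  assumes "0 \<le> l" "0 \<le> m" "cmod c = 1" "cmod d = 1"
  shows "schmidt_decomposition
    (complex_of_real l *s (c *s ket2 0 1) + complex_of_real m *s (d *s ket2 1 0))
    [(l, c *s ket2 0 1), (m, d *s ket2 1 0)]"
proof -
  have "cnj c * c = 1" "cnj d * d = 1"
    using assms complex_norm_square[of c] complex_norm_square[of d] by (simp_all add: mult.commute)
  then have "orthonormal_family [c *s ket 0, d *s ket 1]"
    by (simp add: orthonormal_family_def cinner_scale cinner_ket less_Suc_eq)
  moreover have "orthonormal_family [ket 1, ket 0]"
    by (simp add: orthonormal_family_def cinner_ket less_Suc_eq)
  ultimately show ?thesis
    using assms unfolding schmidt_decomposition_def
    \<comment> \<open>The phases go into the first factor; unit modulus keeps that family
      orthonormal.\<close>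
    by (intro conjI exI[of _ "[c *s ket 0, d *s ket 1]"] exI[of _ "[ket 1, ket 0]"])
      (simp_all add: tensor_scale_left ket2_def)
qed

theorem proposition4:
  "{\<psi> :: two_qubit. is_state \<psi> \<and> entangled \<psi> \<and> diagonal \<psi> \<and> cinner (ket2 0 0) \<psi> = 0} =
     {complex_of_real (cmod a) *s ((a / complex_of_real (cmod a)) *s ket2 0 1) +
      complex_of_real (cmod b) *s ((b / complex_of_real (cmod b)) *s ket2 1 0) | a b :: complex.
        a \<noteq> 0 \<and> b \<noteq> 0 \<and> (cmod a)\<^sup>2 + (cmod b)\<^sup>2 = 1} \<and>
   (\<forall>a b :: complex. a \<noteq> 0 \<and> b \<noteq> 0 \<and> (cmod a)\<^sup>2 + (cmod b)\<^sup>2 = 1 \<longrightarrow>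
      schmidt_decomposition
        (complex_of_real (cmod a) *s ((a / complex_of_real (cmod a)) *s ket2 0 1) +
         complex_of_real (cmod b) *s ((b / complex_of_real (cmod b)) *s ket2 1 0))
        [(cmod a, (a / complex_of_real (cmod a)) *s ket2 0 1),
         (cmod b, (b / complex_of_real (cmod b)) *s ket2 1 0)])"
proof -
  \<comment> \<open>For a = 0 both sides vanish, so this rewrites under the binders of the set
    comprehension without a side condition.\<close>
  have polar: "complex_of_real (cmod a) *s ((a / complex_of_real (cmod a)) *s x) = a *s x"
    for a and x :: two_qubit
    by simp
  show ?thesis
  proof (intro conjI allI impI, goal_cases)
    case 1
    show ?case
      unfolding polar by (simp only: entangled_diagonal_orthogonal_iff)
  next
    case (2 a b)
    then show ?case
      \<comment> \<open>As a and b are nonzero, a/|a| and b/|b| have modulus one and are the phases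
        c and d.\<close>
      by (intro schmidt_decomposition_01_10) (simp_all add: norm_divide)
  qed
qed

end
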